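(* Let $d,N\in\mathbb{N}$, $\ell\in\mathbb{N}_0$, and let $X=(X_1,\ldots,X_N)$ be a random vector on a probability space $(\Omega,\mathcal{F},\mathbb{P})$, where $X_1,\ldots,X_N$ are $\mathbb{R}^d$-valued random variables having the same marginal distribution under $\mathbb{P}$ (not necessarily independent). Let $\mathcal{L}$ be either of the two persistence statistics $\mathcal{L}_{\ell,\mathrm{total}}$, $\mathcal{L}_{\ell,\mathrm{max}}:(\mathbb{R}^d)^N\to\mathbb{R}$ (total, respectively maximum, persistence in degree $\ell$ of the Vietoris--Rips filtration). Then for any $p\ge 1$, $$\mathbb{E}\left[\mathcal{L}(X)^p\right]\le C_{\ell,p}^{\mathrm{VR}}(N)\,\mathbb{E}\left[\|X_1\|^p\right],$$ where $\|\cdot\|$ is the Euclidean norm and $$n_\ell(N):=\min\left\{\binom{N}{\ell+1},\binom{N}{\ell+2}\right\},\qquad C_{\ell,p}^{\mathrm{VR}}(N):=2^{p}N\left(n_\ell(N)\right)^p .$$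
   Context: For $x=(x_1,\ldots,x_N)\in(\mathbb{R}^d)^N$ the Vietoris--Rips filtration on the full simplex (all nonempty subsets $\sigma\subset\{1,\ldots,N\}$) is $\Phi_\sigma(x):=\max_{i,j\in\sigma}\|x_i-x_j\|$ (parametrized by diameter; vertices have value $0$). $\mathcal{D}_\ell(x)$ denotes its persistence diagram in homological degree $\ell$ (simplicial homology with coefficients in $\mathbb{Z}/2\mathbb{Z}$): the finite multiset of birth--death pairs $(b,d)$ with $b<d\le\infty$ (points on the diagonal carry zero persistence). Define $$\mathcal{L}_{\ell,\mathrm{total}}(x)=\sum_{(b,d)\in\mathcal{D}_\ell(x),\,d<\infty}(d-b),\qquad \mathcal{L}_{\ell,\mathrm{max}}(x)=\max_{(b,d)\in\mathcal{D}_\ell(x),\,d<\infty}(d-b),$$ the sum being taken with multiplicities; both are $0$ if there is no finite pair. Both maps are measurable. Expectations of nonnegative random variables may be $+\infty$, with the convention $0\cdot\infty=0$. *)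

theory Defs
  imports
    "HOL-Probability.Probability"
    "HOL-Library.Z2"
    "HOL-Algebra.AbelCoset"
    "Jordan_Normal_Form.Missing_VectorSpace"
begin

section \<open>Quotients of vector spaces\<close>

definition F2 :: "bit ring" where
  "F2 = \<lparr>carrier = UNIV, mult = (*), one = 1, zero = 0, add = (+)\<rparr>"

text \<open>The multiplicative part of a module record carries no meaning.\<close>

definition quotient_module :: "('a, 'v, 'm) module_scheme \<Rightarrow> 'v set \<Rightarrow> ('a, 'v set) module" where
  "quotient_module V W =
     \<lparr>carrier = a_rcosets\<^bsub>V\<^esub> W, mult = undefined, one = undefined, zero = W,
      add = set_add V, smult = (\<lambda>a A. \<Union>v\<in>A. W +>\<^bsub>V\<^esub> (a \<odot>\<^bsub>V\<^esub> v))\<rparr>"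


section \<open>Simplicial homology with coefficients in Z/2\<close>

text \<open>A simplicial complex is given by its set of (nonempty) simplices. An \<open>l\<close>-chain is a
  function on finite vertex sets supported on the \<open>l\<close>-simplices.\<close>

definition chain_space :: "nat \<Rightarrow> nat set set \<Rightarrow> (bit, nat set \<Rightarrow> bit) module" where
  "chain_space l K =
     \<lparr>carrier = {c. \<forall>\<sigma>. c \<sigma> \<noteq> 0 \<longrightarrow> \<sigma> \<in> K \<and> card \<sigma> = l + 1},
      mult = undefined, one = undefined, zero = (\<lambda>\<sigma>. 0),
      add = (\<lambda>c c' \<sigma>. c \<sigma> + c' \<sigma>), smult = (\<lambda>a c \<sigma>. a * c \<sigma>)\<rparr>"

text \<open>The boundary of a simplex is the sum of its facets. The empty face is discarded, so that
  the boundary of a vertex is zero and homology is unreduced.\<close>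

definition boundary :: "(nat set \<Rightarrow> bit) \<Rightarrow> (nat set \<Rightarrow> bit)" where
  "boundary c = (\<lambda>\<tau>. if \<tau> = {} then 0 else \<Sum>\<sigma> | c \<sigma> \<noteq> 0 \<and> (\<exists>v\<in>\<sigma>. \<tau> = \<sigma> - {v}). c \<sigma>)"

definition cycles :: "nat \<Rightarrow> nat set set \<Rightarrow> (nat set \<Rightarrow> bit) set" where
  "cycles l K = {c \<in> carrier (chain_space l K). boundary c = (\<lambda>\<tau>. 0)}"

definition boundaries :: "nat \<Rightarrow> nat set set \<Rightarrow> (nat set \<Rightarrow> bit) set" where
  "boundaries l K = boundary ` carrier (chain_space (l + 1) K)"

definition homology :: "nat \<Rightarrow> nat set set \<Rightarrow> (bit, (nat set \<Rightarrow> bit) set) module" where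
  "homology l K = quotient_module ((chain_space l K)\<lparr>carrier := cycles l K\<rparr>) (boundaries l K)"

text \<open>The map \<open>H\<^sub>l(K) \<rightarrow> H\<^sub>l(K')\<close> induced by an inclusion \<open>K \<subseteq> K'\<close>, sending the class of a cycle
  \<open>z\<close> in \<open>K\<close> to its class in \<open>K'\<close>. The union runs over all representatives of the class \<open>h\<close>; each
  of them yields the same coset.\<close>

definition homology_map ::
  "nat \<Rightarrow> nat set set \<Rightarrow> (nat set \<Rightarrow> bit) set \<Rightarrow> (nat set \<Rightarrow> bit) set" where
  "homology_map l K' h = (\<Union>z\<in>h. boundaries l K' +>\<^bsub>chain_space l K'\<^esub> z)"

definition persistent_betti :: "nat \<Rightarrow> nat set set \<Rightarrow> nat set set \<Rightarrow> nat" where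
  "persistent_betti l K K' =
     vectorspace.dim F2
       ((homology l K')\<lparr>carrier := homology_map l K' ` carrier (homology l K)\<rparr>)"


section \<open>Persistence diagrams of finite filtered complexes\<close>

text \<open>\<open>f\<close> gives the filtration values of the simplices of \<open>K\<close>.\<close>

definition sublevel :: "nat set set \<Rightarrow> (nat set \<Rightarrow> real) \<Rightarrow> ereal \<Rightarrow> nat set set" where
  "sublevel K f t = {\<sigma> \<in> K. ereal (f \<sigma>) \<le> t}"

definition strict_sublevel :: "nat set set \<Rightarrow> (nat set \<Rightarrow> real) \<Rightarrow> ereal \<Rightarrow> nat set set" where
  "strict_sublevel K f t = {\<sigma> \<in> K. ereal (f \<sigma>) < t}"

text \<open>Multiplicity of the point \<open>(b, d)\<close> with \<open>b < d\<close>: the number of classes born at \<open>b\<close> (present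
  at \<open>b\<close> but not coming from any earlier complex) that are still alive just before \<open>d\<close>, minus the
  number of those still alive at \<open>d\<close>. As the complex is finite, the strict sublevel complex at
  \<open>t\<close> is the complex at all parameters slightly smaller than \<open>t\<close>. For \<open>d = \<infinity>\<close> nothing is
  subtracted, since essential classes never die.\<close>

definition born_alive_before :: "nat \<Rightarrow> nat set set \<Rightarrow> (nat set \<Rightarrow> real) \<Rightarrow> real \<Rightarrow> ereal \<Rightarrow> int" where
  "born_alive_before l K f b d =
     int (persistent_betti l (sublevel K f (ereal b)) (strict_sublevel K f d))
     - int (persistent_betti l (strict_sublevel K f (ereal b)) (strict_sublevel K f d))"

definition born_alive_at :: "nat \<Rightarrow> nat set set \<Rightarrow> (nat set \<Rightarrow> real) \<Rightarrow> real \<Rightarrow> ereal \<Rightarrow> int" where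
  "born_alive_at l K f b d =
     int (persistent_betti l (sublevel K f (ereal b)) (sublevel K f d))
     - int (persistent_betti l (strict_sublevel K f (ereal b)) (sublevel K f d))"

definition pd_multiplicity :: "nat \<Rightarrow> nat set set \<Rightarrow> (nat set \<Rightarrow> real) \<Rightarrow> real \<Rightarrow> ereal \<Rightarrow> nat" where
  "pd_multiplicity l K f b d =
     nat (born_alive_before l K f b d - (if d = \<infinity> then 0 else born_alive_at l K f b d))"

text \<open>Births and finite deaths happen only at filtration values, so these points suffice.\<close>

definition persistence_diagram ::
  "nat \<Rightarrow> nat set set \<Rightarrow> (nat set \<Rightarrow> real) \<Rightarrow> (real \<times> ereal) multiset" where
  "persistence_diagram l K f =
     (\<Sum>(b, d) \<in> {(b, d). b \<in> f ` K \<and> d \<in> insert \<infinity> (ereal ` f ` K) \<and> ereal b < d}.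
        replicate_mset (pd_multiplicity l K f b d) (b, d))"


section \<open>Vietoris--Rips persistence\<close>

text \<open>A point of \<open>(\<real>\<^sup>d)\<^sup>N\<close> is represented by a function on \<open>nat\<close>, of which only the values at
  \<open>1, \<dots>, N\<close> are used.\<close>

definition full_simplex :: "nat \<Rightarrow> nat set set" where
  "full_simplex N = {\<sigma>. \<sigma> \<noteq> {} \<and> \<sigma> \<subseteq> {1..N}}"

definition vietoris_rips :: "(nat \<Rightarrow> real ^ 'd) \<Rightarrow> nat set \<Rightarrow> real" where
  "vietoris_rips x \<sigma> = Max {norm (x i - x j) | i j. i \<in> \<sigma> \<and> j \<in> \<sigma>}"

definition vr_diagram :: "nat \<Rightarrow> nat \<Rightarrow> (nat \<Rightarrow> real ^ 'd) \<Rightarrow> (real \<times> ereal) multiset" where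
  "vr_diagram l N x = persistence_diagram l (full_simplex N) (vietoris_rips x)"

definition finite_lifetimes :: "(real \<times> ereal) multiset \<Rightarrow> real multiset" where
  "finite_lifetimes D = {#real_of_ereal d - b. (b, d) \<in># filter_mset (\<lambda>(b, d). d < \<infinity>) D#}"

definition total_persistence :: "nat \<Rightarrow> nat \<Rightarrow> (nat \<Rightarrow> real ^ 'd) \<Rightarrow> real" where
  "total_persistence l N x = \<Sum>\<^sub># (finite_lifetimes (vr_diagram l N x))"

definition max_persistence :: "nat \<Rightarrow> nat \<Rightarrow> (nat \<Rightarrow> real ^ 'd) \<Rightarrow> real" where
  "max_persistence l N x =
     (let P = finite_lifetimes (vr_diagram l N x) in if P = {#} then 0 else Max (set_mset P))"

definition n_VR :: "nat \<Rightarrow> nat \<Rightarrow> nat" where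
  "n_VR l N = min (N choose (l + 1)) (N choose (l + 2))"

definition C_VR :: "nat \<Rightarrow> real \<Rightarrow> nat \<Rightarrow> real" where
  "C_VR l p N = 2 powr p * real N * real (n_VR l N) powr p"

end

theory Submission
  imports Defs "HOL-Library.Function_Algebras"
begin

text \<open>
  Write \<open>r(s, t)\<close> for the dimension of \<open>Z\<^sub>l(K\<^sub>s) \<inter> B\<^sub>l(K\<^sub>t)\<close>, where \<open>K\<^sub>s\<close> is the sublevel complex
  at \<open>s\<close>. The persistent Betti number of the pair \<open>(s, t)\<close> is \<open>dim Z\<^sub>l(K\<^sub>s) - r(s, t)\<close>, so the
  multiplicity of \<open>(b, d)\<close> in the diagram is
  \<open>r(b, d) - r(b-, d) - r(b, d-) + r(b-, d-)\<close>. This expression makes sense and is nonnegative for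
  all pairs \<open>b, d\<close> of filtration values, also those with \<open>d \<le> b\<close>, by submodularity of the
  dimension. Its sum over all pairs telescopes to at most \<open>dim (Z\<^sub>l(K) \<inter> B\<^sub>l(K))\<close>, which is bounded
  both by the number of \<open>l\<close>-simplices and by the number of \<open>(l+1)\<close>-simplices. Hence there are at
  most \<open>n\<^sub>l(N)\<close> finite pairs, each of lifetime at most the diameter \<open>\<le> 2 max\<^sub>i \<parallel>x\<^sub>i\<parallel>\<close>, and
  the \<open>p\<close>-th power of the maximum is bounded by the sum of the \<open>p\<close>-th powers.

  All spaces of chains are finite, so that dimensions over \<open>F2\<close> are computed as binary logarithms
  of cardinalities.
\<close>


section \<open>Finite subgroups and vector spaces over the field with two elements\<close>

text \<open>Phrased for sets in a type-class group: chains can then be added pointwise as functions,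
  and the module records matter only where homology is unfolded.\<close>

definition is_subgroup :: "'a::ab_group_add set \<Rightarrow> bool" where
  "is_subgroup S \<longleftrightarrow> 0 \<in> S \<and> (\<forall>x\<in>S. \<forall>y\<in>S. x - y \<in> S)"

lemma is_subgroup_zero: "is_subgroup S \<Longrightarrow> 0 \<in> S"
  and is_subgroup_diff: "is_subgroup S \<Longrightarrow> x \<in> S \<Longrightarrow> y \<in> S \<Longrightarrow> x - y \<in> S"
  by (auto simp: is_subgroup_def)

lemma is_subgroup_minus: "is_subgroup S \<Longrightarrow> x \<in> S \<Longrightarrow> - x \<in> S"
  using is_subgroup_diff[of S 0 x] is_subgroup_zero[of S] by simp

lemma is_subgroup_add: "is_subgroup S \<Longrightarrow> x \<in> S \<Longrightarrow> y \<in> S \<Longrightarrow> x + y \<in> S"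
  using is_subgroup_diff[of S x "- y"] is_subgroup_minus[of S y] by simp

lemma is_subgroup_Int: "is_subgroup S \<Longrightarrow> is_subgroup T \<Longrightarrow> is_subgroup (S \<inter> T)"
  by (auto simp: is_subgroup_def)

definition coset :: "'a::ab_group_add set \<Rightarrow> 'a \<Rightarrow> 'a set" where
  "coset T z = (\<lambda>t. t + z) ` T"

lemma coset_eq_iff:
  assumes "is_subgroup T"
  shows "coset T x = coset T y \<longleftrightarrow> x - y \<in> T"
proof
  assume "coset T x = coset T y"
  then have "0 + x \<in> coset T y"
    using is_subgroup_zero[OF assms] by (auto simp: coset_def)
  then show "x - y \<in> T" by (auto simp: coset_def)
next
  assume xy: "x - y \<in> T"
  show "coset T x = coset T y"
    unfolding coset_def
  proof (intro equalityI image_subsetI)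
    fix t assume t: "t \<in> T"
    show "t + x \<in> (\<lambda>t. t + y) ` T"
      using is_subgroup_add[OF assms t xy] by (intro image_eqI[of _ _ "t + (x - y)"]) auto
    show "t + y \<in> (\<lambda>t. t + x) ` T"
      using is_subgroup_diff[OF assms t xy] by (intro image_eqI[of _ _ "t - (x - y)"]) auto
  qed
qed

text \<open>The second isomorphism theorem by counting: the fibres of \<open>coset T\<close> on
  \<open>S\<close> are translates of \<open>S \<inter> T\<close>. In the application
  \<open>T\<close> consists of boundaries in a larger complex and need not lie in
  \<open>S\<close>.\<close>

lemma card_subgroup_eq:
  assumes fin: "finite S" and S: "is_subgroup S" and T: "is_subgroup T"
  shows "card S = card (coset T ` S) * card (S \<inter> T)"
proof -
  have fibre: "card {x \<in> S. coset T x = c} = card (S \<inter> T)" if "c \<in> coset T ` S" for c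
  proof -
    from that obtain a where a: "a \<in> S" "c = coset T a" by auto
    have "{x \<in> S. coset T x = c} = (\<lambda>t. t + a) ` (S \<inter> T)"
    proof (intro equalityI subsetI)
      fix x assume "x \<in> {x \<in> S. coset T x = c}"
      then show "x \<in> (\<lambda>t. t + a) ` (S \<inter> T)"
        using a is_subgroup_diff[OF S, of x a]
        by (intro image_eqI[of _ _ "x - a"]) (auto simp: coset_eq_iff[OF T])
    next
      fix x assume "x \<in> (\<lambda>t. t + a) ` (S \<inter> T)"
      then show "x \<in> {x \<in> S. coset T x = c}"
        using a is_subgroup_add[OF S] by (auto simp: coset_eq_iff[OF T])
    qed
    then show ?thesis by (simp add: card_image)
  qed
  have "card S = (\<Sum>c\<in>coset T ` S. card {x \<in> S. coset T x = c})"
    using sum.image_gen[OF fin, of "\<lambda>_. 1::nat" "coset T"] by simp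
  also have "\<dots> = card (coset T ` S) * card (S \<inter> T)"
    using fibre by simp
  finally show ?thesis .
qed

text \<open>\<open>W / (U \<inter> W)\<close> embeds into \<open>S / U\<close>. After taking
  logarithms this is submodularity of the dimension.\<close>

lemma card_subgroup_mult_le:
  assumes "finite S" "is_subgroup S" "is_subgroup U" "is_subgroup W" "U \<subseteq> S" "W \<subseteq> S"
  shows "card U * card W \<le> card S * card (U \<inter> W)"
proof -
  have fin: "finite U" "finite W" using assms finite_subset by blast+
  have "card W = card (coset U ` W) * card (U \<inter> W)"
    using card_subgroup_eq[OF fin(2) assms(4,3)] by (simp add: Int_commute)
  moreover have "card S = card (coset U ` S) * card U"
    using card_subgroup_eq[OF assms(1-3)] assms(5) by (simp add: Int_absorb1)
  moreover have "card (coset U ` W) \<le> card (coset U ` S)"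
    using assms by (intro card_mono finite_imageI image_mono)
  ultimately show ?thesis by (simp add: mult_le_mono)
qed

section \<open>Dimension over the field with two elements by counting\<close>

lemma field_F2: "field F2"
proof -
  have "cring F2"
  proof (intro cringI abelian_groupI)
    show "comm_monoid F2" by standard (auto simp: F2_def)
    show "\<exists>y\<in>carrier F2. y \<oplus>\<^bsub>F2\<^esub> x = \<zero>\<^bsub>F2\<^esub>" for x
      by (rule bexI[of _ x]) (auto simp: F2_def)
  qed (auto simp: F2_def algebra_simps)
  then show ?thesis
    by (rule cring.cring_fieldI2) (auto simp: F2_def)
qed

text \<open>Coordinates with respect to a basis \<open>A\<close> identify the space with the
  functions from \<open>A\<close> to a two-element set.\<close>

lemma card_vectorspace_F2:
  assumes V: "vectorspace F2 V" and fin: "finite (carrier V)"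
  shows "card (carrier V) = 2 ^ vectorspace.dim F2 V"
proof -
  interpret V: vectorspace F2 V by (rule V)
  have "V.gen_set (carrier V)"
    using V.in_own_span[of "carrier V"] V.span_is_subset2[of "carrier V"] by auto
  then have "V.fin_dim"
    using fin unfolding V.fin_dim_def by blast
  then obtain A where A: "finite A" "V.basis A"
    using V.finite_basis_exists by blast
  then have AV: "A \<subseteq> carrier V" by (simp add: V.basis_def)
  have uniq: "\<exists>!a. a \<in> A \<rightarrow>\<^sub>E carrier F2 \<and> V.lincomb a A = v" if "v \<in> carrier V" for v
    using V.basis_criterion[OF A(1) AV] A(2) that by blast
  have cl: "V.lincomb a A \<in> carrier V" if "a \<in> A \<rightarrow>\<^sub>E carrier F2" for a
    using that AV by (intro V.lincomb_closed) (auto simp: F2_def)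
  have "bij_betw (\<lambda>a. V.lincomb a A) (A \<rightarrow>\<^sub>E carrier F2) (carrier V)"
    unfolding bij_betw_def
  proof
    show "inj_on (\<lambda>a. V.lincomb a A) (A \<rightarrow>\<^sub>E carrier F2)"
      using uniq cl by (intro inj_onI) metis
    show "(\<lambda>a. V.lincomb a A) ` (A \<rightarrow>\<^sub>E carrier F2) = carrier V"
      using uniq cl by blast
  qed
  then have "card (carrier V) = card (A \<rightarrow>\<^sub>E carrier F2)"
    by (metis bij_betw_same_card)
  also have "\<dots> = card (UNIV :: bit set) ^ card A"
    using A(1) by (simp add: card_PiE F2_def)
  also have "(UNIV :: bit set) = {0, 1}"
    by (auto intro: bit.exhaust)
  finally show ?thesis
    using V.dim_basis[OF A] by (simp add: numeral_2_eq_2)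
qed

text \<open>Intended for images of homology maps, with \<open>Z\<close> the cycles of the smaller
  complex and \<open>T\<close> the boundaries of the larger one. All axioms pass from
  representatives to cosets.\<close>

lemma vectorspace_F2_cosets:
  fixes T Z :: "'a::ab_group_add set" and V :: "(bit, 'a set, 'm) module_scheme"
  assumes char2: "\<And>x::'a. x + x = 0"
    and Z: "is_subgroup Z" and T: "is_subgroup T"
    and carrier: "carrier V = coset T ` Z"
    and zero: "\<zero>\<^bsub>V\<^esub> = T"
    and add: "\<And>x y. coset T x \<oplus>\<^bsub>V\<^esub> coset T y = coset T (x + y)"
    and smult: "\<And>a x. a \<odot>\<^bsub>V\<^esub> coset T x = coset T (if a = 0 then 0 else x)"
  shows "vectorspace F2 V"
proof -
  have T0: "T = coset T 0" by (simp add: coset_def)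
  have zero': "\<zero>\<^bsub>V\<^esub> = coset T 0" using zero T0 by simp
  note ZI = is_subgroup_zero[OF Z] is_subgroup_add[OF Z]
  \<comment> \<open>In characteristic 2 every element is its own negative, so \<open>w = v\<close>
    is a witness.\<close>
  have neg: "\<exists>w\<in>Z. coset T (v + w) = coset T 0" if "v \<in> Z" for v
    using that char2[of v] by metis
  show ?thesis
    by (rule vs_criteria[OF field_F2])
       (auto simp: carrier zero' add smult F2_def ZI char2 neg ac_simps)
qed


section \<open>Chains, cycles and boundaries\<close>

lemma chain_add_self: "c + c = (0 :: 'b \<Rightarrow> bit)"
  by (rule ext) simp

lemma chain_diff: "c - c' = c + (c' :: 'b \<Rightarrow> bit)"
  by (rule ext) simp

lemma is_subgroup_chainI:
  "0 \<in> S \<Longrightarrow> (\<And>x y. x \<in> S \<Longrightarrow> y \<in> S \<Longrightarrow> x + y \<in> S) \<Longrightarrow> is_subgroup (S :: ('b \<Rightarrow> bit) set)"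
  unfolding is_subgroup_def chain_diff by blast

abbreviation chains :: "nat \<Rightarrow> nat set set \<Rightarrow> (nat set \<Rightarrow> bit) set" where
  "chains l K \<equiv> carrier (chain_space l K)"

lemma chains_eq: "chains l K = {c. \<forall>\<sigma>. c \<sigma> \<noteq> 0 \<longrightarrow> \<sigma> \<in> K \<and> card \<sigma> = l + 1}"
  by (simp add: chain_space_def)

lemma chains_mono: "K \<subseteq> K' \<Longrightarrow> chains l K \<subseteq> chains l K'"
  unfolding chains_eq by blast

lemma is_subgroup_chains: "is_subgroup (chains l K)"
proof (rule is_subgroup_chainI)
  fix x y assume "x \<in> chains l K" "y \<in> chains l K"
  then show "x + y \<in> chains l K"
    unfolding chains_eq by (auto simp: plus_fun_def)
qed (simp add: chains_eq)

text \<open>With coefficients in Z/2 a chain is determined by its support, an arbitrary set of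
  \<open>l\<close>-simplices.\<close>

lemma bij_betw_chains: "bij_betw (\<lambda>c. {\<sigma>. c \<sigma> \<noteq> 0}) (chains l K) (Pow {\<sigma> \<in> K. card \<sigma> = l + 1})"
  by (rule bij_betw_byWitness[where f' = "\<lambda>S \<sigma>. if \<sigma> \<in> S then 1 else 0"])
     (auto simp: chains_eq fun_eq_iff split: if_splits)

lemma finite_chains: "finite K \<Longrightarrow> finite (chains l K)"
  using bij_betw_finite[OF bij_betw_chains[of l K]] by simp

lemma card_chains:
  assumes "finite K" shows "card (chains l K) = 2 ^ card {\<sigma> \<in> K. card \<sigma> = l + 1}"
  using bij_betw_same_card[OF bij_betw_chains[of l K]] assms by (simp add: card_Pow)

text \<open>The index set in \<open>boundary_def\<close> depends on \<open>c\<close>. Replacing it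
  by one that depends only on \<open>K\<close> lets two boundaries be added termwise.\<close>

lemma boundary_eq_sum:
  assumes K: "finite K" and c: "c \<in> chains l K"
  shows "boundary c \<tau> = (if \<tau> = {} then 0 else \<Sum>\<sigma> | \<sigma> \<in> K \<and> (\<exists>v\<in>\<sigma>. \<tau> = \<sigma> - {v}). c \<sigma>)"
proof -
  have "(\<Sum>\<sigma> | c \<sigma> \<noteq> 0 \<and> (\<exists>v\<in>\<sigma>. \<tau> = \<sigma> - {v}). c \<sigma>) = (\<Sum>\<sigma> | \<sigma> \<in> K \<and> (\<exists>v\<in>\<sigma>. \<tau> = \<sigma> - {v}). c \<sigma>)"
    using K c by (intro sum.mono_neutral_left) (auto simp: chains_eq)
  then show ?thesis by (simp only: boundary_def)
qed

lemma boundary_zero: "boundary 0 = 0"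
  by (rule ext) (simp add: boundary_def)

lemma boundary_add:
  assumes K: "finite K" and c: "c \<in> chains l K" "c' \<in> chains l K"
  shows "boundary (c + c') = boundary c + boundary c'"
  by (rule ext)
     (simp only: plus_fun_apply boundary_eq_sum[OF K] boundary_eq_sum[OF K c(1)]
       boundary_eq_sum[OF K c(2)] boundary_eq_sum[OF K is_subgroup_add[OF is_subgroup_chains c]]
       sum.distrib split: if_split, simp)

lemma cycles_eq: "cycles l K = {c \<in> chains l K. boundary c = 0}"
  by (simp add: cycles_def zero_fun_def)

lemma cycles_mono: "K \<subseteq> K' \<Longrightarrow> cycles l K \<subseteq> cycles l K'"
  using chains_mono[of K K' l] by (auto simp: cycles_def)

lemma boundaries_mono: "K \<subseteq> K' \<Longrightarrow> boundaries l K \<subseteq> boundaries l K'"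
  using chains_mono[of K K' "l + 1"] by (auto simp: boundaries_def)

lemma is_subgroup_cycles: "finite K \<Longrightarrow> is_subgroup (cycles l K)"
  unfolding cycles_eq
  by (rule is_subgroup_chainI)
     (auto simp: boundary_zero boundary_add is_subgroup_zero[OF is_subgroup_chains]
       is_subgroup_add[OF is_subgroup_chains])

lemma is_subgroup_boundaries:
  assumes "finite K" shows "is_subgroup (boundaries l K)"
proof (rule is_subgroup_chainI)
  show "0 \<in> boundaries l K"
    unfolding boundaries_def using is_subgroup_zero[OF is_subgroup_chains] boundary_zero
    by (metis image_eqI)
next
  fix x y assume "x \<in> boundaries l K" "y \<in> boundaries l K"
  then show "x + y \<in> boundaries l K"
    unfolding boundaries_def using boundary_add[OF assms] is_subgroup_add[OF is_subgroup_chains]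
    by (smt (verit) image_iff)
qed

lemma finite_cycles: "finite K \<Longrightarrow> finite (cycles l K)"
  by (rule finite_subset[OF _ finite_chains[of K l]]) (auto simp: cycles_def)

section \<open>Homology operations on concrete cosets\<close>

lemma a_r_coset_chain_space: "T +>\<^bsub>chain_space l K\<^esub> z = coset T z"
  by (auto simp: a_r_coset_def' coset_def chain_space_def plus_fun_def)

lemma a_r_coset_cycles: "T +>\<^bsub>(chain_space l K)\<lparr>carrier := C\<rparr>\<^esub> z = coset T z"
  by (auto simp: a_r_coset_def' coset_def chain_space_def plus_fun_def)

lemma smult_chain_space: "a \<odot>\<^bsub>chain_space l K\<^esub> c = (\<lambda>\<sigma>. a * c \<sigma>)"
  by (simp add: chain_space_def)

lemma carrier_homology: "carrier (homology l K) = coset (boundaries l K) ` cycles l K"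
  by (auto simp: homology_def quotient_module_def A_RCOSETS_def RCOSETS_def r_coset_def coset_def
      chain_space_def plus_fun_def)

text \<open>Collapses the unions over all representatives in \<open>homology_map\<close> and in the
  scalar multiplication of \<open>quotient_module\<close> to a single coset.\<close>

lemma Union_coset:
  assumes T: "is_subgroup T" and A: "A \<noteq> {}" "\<And>a. a \<in> A \<Longrightarrow> a - x \<in> T"
  shows "(\<Union>a\<in>A. coset T a) = coset T x"
proof -
  have "coset T a = coset T x" if "a \<in> A" for a
    using A(2)[OF that] by (simp add: coset_eq_iff[OF T])
  then show ?thesis using A(1) by simp
qed

lemma homology_map_coset:
  assumes "K \<subseteq> K'" "finite K'"
  shows "homology_map l K' (coset (boundaries l K) z) = coset (boundaries l K') z"
proof -
  have fin: "finite K" using assms finite_subset by blast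
  show ?thesis
    unfolding homology_map_def a_r_coset_chain_space
  proof (rule Union_coset[OF is_subgroup_boundaries[OF assms(2)]])
    show "coset (boundaries l K) z \<noteq> {}"
      using is_subgroup_zero[OF is_subgroup_boundaries[OF fin]] by (auto simp: coset_def)
  qed (use boundaries_mono[OF assms(1), of l] in \<open>auto simp: coset_def\<close>)
qed

lemma add_homology_coset:
  assumes "finite K"
  shows "coset (boundaries l K) x \<oplus>\<^bsub>homology l K\<^esub> coset (boundaries l K) y
    = coset (boundaries l K) (x + y)" (is "?L = ?R")
proof -
  note T = is_subgroup_boundaries[OF assms, of l]
  have L: "?L = (\<Union>s\<in>boundaries l K. \<Union>t\<in>boundaries l K. {(s + x) + (t + y)})"
    by (simp add: homology_def quotient_module_def set_add_def set_mult_def chain_space_def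
        coset_def plus_fun_def)
  show ?thesis
  proof (intro equalityI subsetI)
    fix u assume "u \<in> ?L"
    then obtain s t where "s \<in> boundaries l K" "t \<in> boundaries l K" "u = (s + t) + (x + y)"
      unfolding L by (auto simp: ac_simps)
    then show "u \<in> ?R" using is_subgroup_add[OF T] by (auto simp: coset_def)
  next
    fix u assume "u \<in> ?R"
    then obtain s where "s \<in> boundaries l K" "u = (s + x) + (0 + y)"
      by (auto simp: coset_def ac_simps)
    then show "u \<in> ?L" unfolding L using is_subgroup_zero[OF T] by blast
  qed
qed

lemma smult_homology_coset:
  assumes "finite K"
  shows "a \<odot>\<^bsub>homology l K\<^esub> coset (boundaries l K) x = coset (boundaries l K) (if a = 0 then 0 else x)"
proof -
  note T = is_subgroup_boundaries[OF assms, of l]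
  have scale: "(\<lambda>\<sigma>. a * v \<sigma>) = (if a = 0 then 0 else v)" for v :: "nat set \<Rightarrow> bit"
    by (cases a) (auto simp: fun_eq_iff)
  have "a \<odot>\<^bsub>homology l K\<^esub> coset (boundaries l K) x
    = (\<Union>v\<in>coset (boundaries l K) x. coset (boundaries l K) (\<lambda>\<sigma>. a * v \<sigma>))"
    by (simp add: homology_def quotient_module_def a_r_coset_cycles smult_chain_space del: bit_not_zero_iff)
  \<comment> \<open>Scaling by 0 sends the nonempty coset to \<open>{0}\<close>, scaling by 1 fixes
    it; in both cases the image lies in one class modulo the boundaries.\<close>
  also have "\<dots> = (\<Union>w\<in>(\<lambda>v. if a = 0 then 0 else v) ` coset (boundaries l K) x. coset (boundaries l K) w)"
    by (simp only: scale image_image)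
  also have "\<dots> = coset (boundaries l K) (if a = 0 then 0 else x)"
    using is_subgroup_zero[OF T]
    by (intro Union_coset[OF T]) (auto simp: coset_def)
  finally show ?thesis .
qed

text \<open>The image of \<open>H\<^sub>l(K) \<rightarrow> H\<^sub>l(K')\<close> is \<open>Z\<^sub>l(K) / (Z\<^sub>l(K) \<inter> B\<^sub>l(K'))\<close>.\<close>

lemma card_cycles:
  assumes "K \<subseteq> K'" "finite K'"
  shows "card (cycles l K) = 2 ^ persistent_betti l K K' * card (cycles l K \<inter> boundaries l K')"
proof -
  have fin: "finite K" using assms finite_subset by blast
  define V where "V = (homology l K')\<lparr>carrier := homology_map l K' ` carrier (homology l K)\<rparr>"
  have carr: "carrier V = coset (boundaries l K') ` cycles l K"
    by (simp add: V_def carrier_homology image_image homology_map_coset[OF assms])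
  have "vectorspace F2 V"
  proof (rule vectorspace_F2_cosets)
    show "\<zero>\<^bsub>V\<^esub> = boundaries l K'"
      by (simp add: V_def homology_def quotient_module_def)
  qed (use carr add_homology_coset[OF assms(2)] smult_homology_coset[OF assms(2)] in
      \<open>simp_all add: V_def chain_add_self is_subgroup_cycles fin is_subgroup_boundaries assms\<close>)
  then have "card (carrier V) = 2 ^ persistent_betti l K K'"
    using card_vectorspace_F2[of V] finite_cycles[OF fin] carr by (simp add: persistent_betti_def V_def)
  then show ?thesis
    using card_subgroup_eq[OF finite_cycles[OF fin] is_subgroup_cycles[OF fin]
        is_subgroup_boundaries[OF assms(2)]] carr by metis
qed

text \<open>The dimension r(s, t) from the idea above. The logarithm of a cardinality avoids making
  the intersection a vector space, and real values allow subtraction.\<close>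

definition bounding_rank :: "nat \<Rightarrow> nat set set \<Rightarrow> nat set set \<Rightarrow> real" where
  "bounding_rank l K K' = log 2 (card (cycles l K \<inter> boundaries l K'))"

lemma is_subgroup_bounding: "finite K \<Longrightarrow> finite K' \<Longrightarrow> is_subgroup (cycles l K \<inter> boundaries l K')"
  by (intro is_subgroup_Int is_subgroup_cycles is_subgroup_boundaries)

lemma card_subgroup_pos: "finite S \<Longrightarrow> is_subgroup S \<Longrightarrow> 0 < card S"
  using is_subgroup_zero card_gt_0_iff by blast

lemma card_bounding_pos:
  "finite K \<Longrightarrow> finite K' \<Longrightarrow> 0 < card (cycles l K \<inter> boundaries l K')"
  by (intro card_subgroup_pos finite_Int is_subgroup_bounding) (auto simp: finite_cycles)

text \<open>The first term depends on \<open>K\<close> alone, so it cancels when only the second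
  complex changes, as it does in a multiplicity.\<close>

lemma persistent_betti_eq:
  assumes "K \<subseteq> K'" "finite K'"
  shows "real (persistent_betti l K K') = log 2 (card (cycles l K)) - bounding_rank l K K'"
proof -
  have "finite K" using assms finite_subset by blast
  from card_bounding_pos[OF this assms(2), of l] show ?thesis
    unfolding bounding_rank_def card_cycles[OF assms]
    by (simp add: log_mult log_nat_power)
qed

text \<open>Both spaces on the left lie in that of the pair \<open>(K\<^sub>1, K\<^sub>3)\<close>
  and meet in that of \<open>(K\<^sub>0, K\<^sub>2)\<close>. Cycles and boundaries are varied
  separately, so births and deaths need not be ordered.\<close>

lemma bounding_rank_submodular:
  assumes "K\<^sub>0 \<subseteq> K\<^sub>1" "K\<^sub>2 \<subseteq> K\<^sub>3" "finite K\<^sub>1" "finite K\<^sub>3"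
  shows "bounding_rank l K\<^sub>0 K\<^sub>3 + bounding_rank l K\<^sub>1 K\<^sub>2
    \<le> bounding_rank l K\<^sub>1 K\<^sub>3 + bounding_rank l K\<^sub>0 K\<^sub>2"
proof -
  have fin: "finite K\<^sub>0" "finite K\<^sub>2" using assms finite_subset by blast+
  note fin = fin assms(3,4)
  let ?I = "\<lambda>K K'. cycles l K \<inter> boundaries l K'"
  have eq: "?I K\<^sub>0 K\<^sub>3 \<inter> ?I K\<^sub>1 K\<^sub>2 = ?I K\<^sub>0 K\<^sub>2"
    using cycles_mono[OF assms(1)] boundaries_mono[OF assms(2)] by blast
  have "card (?I K\<^sub>0 K\<^sub>3) * card (?I K\<^sub>1 K\<^sub>2) \<le> card (?I K\<^sub>1 K\<^sub>3) * card (?I K\<^sub>0 K\<^sub>3 \<inter> ?I K\<^sub>1 K\<^sub>2)"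
    using cycles_mono[OF assms(1)] boundaries_mono[OF assms(2)] fin
    by (intro card_subgroup_mult_le is_subgroup_bounding) (auto simp: finite_cycles)
  then have "real (card (?I K\<^sub>0 K\<^sub>3)) * card (?I K\<^sub>1 K\<^sub>2) \<le> real (card (?I K\<^sub>1 K\<^sub>3)) * card (?I K\<^sub>0 K\<^sub>2)"
    unfolding eq of_nat_mult[symmetric] by (rule of_nat_mono)
  then have "log 2 (real (card (?I K\<^sub>0 K\<^sub>3)) * card (?I K\<^sub>1 K\<^sub>2))
      \<le> log 2 (real (card (?I K\<^sub>1 K\<^sub>3)) * card (?I K\<^sub>0 K\<^sub>2))"
    using card_bounding_pos fin by (subst log_le_cancel_iff) auto
  then show ?thesis
    using card_bounding_pos[OF fin(1,4), of l] card_bounding_pos[OF fin(3,2), of l]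
      card_bounding_pos[OF fin(3,4), of l] card_bounding_pos[OF fin(1,2), of l]
    by (simp add: bounding_rank_def log_mult)
qed

lemma bounding_rank_nonneg:
  assumes "finite K" "finite K'" shows "0 \<le> bounding_rank l K K'"
  using card_bounding_pos[OF assms, of l] by (simp add: bounding_rank_def zero_le_log_cancel_iff)

lemma bounding_rank_le_exponent:
  assumes "finite K" "finite K'" "card (cycles l K \<inter> boundaries l K') \<le> 2 ^ n"
  shows "bounding_rank l K K' \<le> n"
proof -
  have "log 2 (card (cycles l K \<inter> boundaries l K')) \<le> log 2 (2 ^ n)"
    using assms card_bounding_pos[OF assms(1,2), of l]
    by (subst log_le_cancel_iff) (auto simp flip: of_nat_le_iff)
  then show ?thesis by (simp add: bounding_rank_def)
qed

text \<open>The intersection sits inside the \<open>l\<close>-chains, and also inside the image of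
  the \<open>(l+1)\<close>-chains under \<open>boundary\<close>.\<close>

lemma bounding_rank_le:
  assumes "finite K"
  shows "bounding_rank l K K \<le> card {\<sigma> \<in> K. card \<sigma> = l + 1}"
    and "bounding_rank l K K \<le> card {\<sigma> \<in> K. card \<sigma> = l + 2}"
proof -
  have "card (cycles l K \<inter> boundaries l K) \<le> card (chains l K)"
    by (intro card_mono finite_chains assms) (auto simp: cycles_def)
  then show "bounding_rank l K K \<le> card {\<sigma> \<in> K. card \<sigma> = l + 1}"
    by (intro bounding_rank_le_exponent assms) (simp add: card_chains assms)
  have "card (cycles l K \<inter> boundaries l K) \<le> card (boundaries l K)"
    by (intro card_mono) (auto simp: boundaries_def finite_chains assms)
  also have "\<dots> \<le> card (chains (l + 1) K)"
    unfolding boundaries_def by (intro card_image_le finite_chains assms)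
  finally show "bounding_rank l K K \<le> card {\<sigma> \<in> K. card \<sigma> = l + 2}"
    by (intro bounding_rank_le_exponent assms) (simp add: card_chains assms)
qed


section \<open>Counting finite persistence pairs\<close>

text \<open>The strict sublevel set at a value is the sublevel set at the preceding value of
  \<open>V\<close>, or empty at the least one. \<open>G\<close> is arbitrary so that either argument
  of \<open>bounding_rank\<close> can be telescoped.\<close>

lemma sum_sublevel_telescope:
  fixes G :: "'b set \<Rightarrow> real" and f :: "'b \<Rightarrow> 'c::linorder"
  assumes "finite V" "f ` K \<subseteq> V"
  shows "(\<Sum>v\<in>V. G {\<sigma> \<in> K. f \<sigma> \<le> v} - G {\<sigma> \<in> K. f \<sigma> < v}) = G K - G {}"
  using assms
proof (induction V arbitrary: K rule: finite_linorder_max_induct)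
  case empty
  then show ?case by simp
next
  case (insert b A)
  \<comment> \<open>Removing the top level \<open>b\<close> leaves the strict sublevel set at
    \<open>b\<close>. The induction hypothesis is applied to this set, hence the generalization over
    \<open>K\<close>.\<close>
  define K0 where "K0 = {\<sigma> \<in> K. f \<sigma> < b}"
  have "f ` K0 \<subseteq> A" using insert.prems by (auto simp: K0_def)
  note IH = insert.IH[OF this]
  have "{\<sigma> \<in> K0. f \<sigma> \<le> v} = {\<sigma> \<in> K. f \<sigma> \<le> v}" "{\<sigma> \<in> K0. f \<sigma> < v} = {\<sigma> \<in> K. f \<sigma> < v}"
    if "v \<in> A" for v
    using insert.hyps(2) that by (force simp: K0_def)+
  with IH have "(\<Sum>v\<in>A. G {\<sigma> \<in> K. f \<sigma> \<le> v} - G {\<sigma> \<in> K. f \<sigma> < v}) = G K0 - G {}"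
    by simp
  moreover have "{\<sigma> \<in> K. f \<sigma> \<le> b} = K"
    using insert.prems insert.hyps(2) by (auto intro: less_imp_le)
  moreover have "b \<notin> A" using insert.hyps(2) by auto
  ultimately show ?case using insert.hyps(1) by (simp add: K0_def)
qed

text \<open>Since \<open>b < d\<close>, all four pairs of complexes are nested, so
  \<open>persistent_betti_eq\<close> applies to each and the cycle dimensions cancel.\<close>

lemma pd_multiplicity_eq:
  fixes f :: "nat set \<Rightarrow> real" and l :: nat and K :: "nat set set"
  defines "S \<equiv> \<lambda>t. {\<sigma> \<in> K. f \<sigma> \<le> t}" and "S' \<equiv> \<lambda>t. {\<sigma> \<in> K. f \<sigma> < t}"
  assumes K: "finite K" and bd: "b < d"
  shows "real (pd_multiplicity l K f b (ereal d))
    = bounding_rank l (S b) (S d) - bounding_rank l (S b) (S' d)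
      - (bounding_rank l (S' b) (S d) - bounding_rank l (S' b) (S' d))" (is "_ = ?\<mu>")
proof -
  have fin: "finite (S t)" "finite (S' t)" for t using K by (auto simp: S_def S'_def)
  have sub: "S b \<subseteq> S d" "S b \<subseteq> S' d" "S' b \<subseteq> S d" "S' b \<subseteq> S' d" "S' b \<subseteq> S b" "S' d \<subseteq> S d"
    using bd by (auto simp: S_def S'_def)
  have lev: "sublevel K f (ereal t) = S t" "strict_sublevel K f (ereal t) = S' t" for t
    by (auto simp: sublevel_def strict_sublevel_def S_def S'_def)
  define m where "m = born_alive_before l K f b (ereal d) - born_alive_at l K f b (ereal d)"
  have m: "real_of_int m = ?\<mu>"
    unfolding m_def born_alive_before_def born_alive_at_def lev
    by (simp add: persistent_betti_eq[OF sub(1) fin(1)] persistent_betti_eq[OF sub(2) fin(2)]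
        persistent_betti_eq[OF sub(3) fin(1)] persistent_betti_eq[OF sub(4) fin(2)])
  \<comment> \<open>Ensures that the truncation \<open>nat\<close> in \<open>pd_multiplicity\<close>
    loses nothing.\<close>
  moreover have "0 \<le> ?\<mu>"
    using bounding_rank_submodular[OF sub(5,6) fin(1) fin(1), of l] by simp
  ultimately have "0 \<le> m" by linarith
  then show ?thesis
    using m by (simp add: pd_multiplicity_def m_def)
qed

lemma pd_multiplicity_sum_le:
  assumes K: "finite K"
  shows "(\<Sum>(b, d) | b \<in> f ` K \<and> d \<in> f ` K \<and> b < d. pd_multiplicity l K f b (ereal d))
    \<le> min (card {\<sigma> \<in> K. card \<sigma> = l + 1}) (card {\<sigma> \<in> K. card \<sigma> = l + 2})" (is "?n \<le> _")
proof -
  let ?S = "\<lambda>t. {\<sigma> \<in> K. f \<sigma> \<le> t}" and ?S' = "\<lambda>t. {\<sigma> \<in> K. f \<sigma> < t}"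
  let ?I = "bounding_rank l" and ?V = "f ` K"
  let ?\<mu> = "\<lambda>b d. ?I (?S b) (?S d) - ?I (?S b) (?S' d) - (?I (?S' b) (?S d) - ?I (?S' b) (?S' d))"
  have V: "finite ?V" using K by simp
  have nonneg: "0 \<le> ?\<mu> b d" for b d
    using bounding_rank_submodular[of "?S' b" "?S b" "?S' d" "?S d" l] K by fastforce
  have "real ?n = (\<Sum>(b, d) | b \<in> ?V \<and> d \<in> ?V \<and> b < d. ?\<mu> b d)"
    unfolding of_nat_sum by (intro sum.cong) (auto simp: pd_multiplicity_eq[OF K])
  \<comment> \<open>Pairs with \<open>d \<le> b\<close> are added to obtain a full rectangle; their
    terms are nonnegative by submodularity.\<close>
  also have "\<dots> \<le> (\<Sum>(b, d) \<in> ?V \<times> ?V. ?\<mu> b d)"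
    using V nonneg by (intro sum_mono2) auto
  also have "\<dots> = (\<Sum>b\<in>?V. \<Sum>d\<in>?V. ?\<mu> b d)"
    by (rule sum.cartesian_product[symmetric])
  \<comment> \<open>Telescoping over deaths for fixed \<open>b\<close>; the next step telescopes
    over births.\<close>
  also have "\<dots> = (\<Sum>b\<in>?V. (?I (?S b) K - ?I (?S b) {}) - (?I (?S' b) K - ?I (?S' b) {}))"
    by (simp only: sum_subtractf[of _ _ ?V] flip: sum_sublevel_telescope[OF V order.refl])
  also have "\<dots> = (?I K K - ?I K {}) - (?I {} K - ?I {} {})"
    by (rule sum_sublevel_telescope[OF V order.refl, of "\<lambda>A. ?I A K - ?I A {}"])
  \<comment> \<open>The two mixed terms are subtracted and nonnegative, while the empty complex has
    rank 0.\<close>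
  also have "\<dots> \<le> ?I K K"
    using bounding_rank_nonneg[of K "{}" l] bounding_rank_nonneg[of "{}" K l]
      bounding_rank_le(1)[of "{}" l] K by simp
  finally have "real ?n \<le> ?I K K" .
  from order.trans[OF this bounding_rank_le(1)[OF K]] order.trans[OF this bounding_rank_le(2)[OF K]]
  show ?thesis unfolding of_nat_le_iff by (rule min.boundedI)
qed

section \<open>From multiplicities to the multiset of lifetimes\<close>

lemma filter_replicate_mset:
  "filter_mset P (replicate_mset n x) = (if P x then replicate_mset n x else {#})"
  by (induction n) auto

lemma size_filter_sum_replicate_mset:
  assumes "finite T"
  shows "size (filter_mset P (\<Sum>x\<in>T. replicate_mset (m x) x)) = (\<Sum>x | x \<in> T \<and> P x. m x)"
proof -
  have "size (filter_mset P (\<Sum>x\<in>T. replicate_mset (m x) x)) = (\<Sum>x\<in>T. if P x then m x else 0)"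
    using assms by (induction T) (simp_all add: filter_replicate_mset)
  then show ?thesis
    using sum.inter_filter[OF assms, of m P] by (simp only:)
qed

lemma persistence_diagram_eq:
  "persistence_diagram l K f =
     (\<Sum>x \<in> {(b, d). b \<in> f ` K \<and> d \<in> insert \<infinity> (ereal ` f ` K) \<and> ereal b < d}.
        replicate_mset (pd_multiplicity l K f (fst x) (snd x)) x)"
  unfolding persistence_diagram_def by (intro sum.cong refl) (simp only: case_prod_beta prod.collapse)

lemma finite_diagram_support:
  assumes "finite K"
  shows "finite {(b, d). b \<in> f ` K \<and> d \<in> insert \<infinity> (ereal ` f ` K) \<and> ereal b < d}"
  by (rule finite_subset[of _ "f ` K \<times> insert \<infinity> (ereal ` f ` K)"])
     (blast, simp only: assms finite_SigmaI finite_imageI finite_insert)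

lemma size_finite_lifetimes_le:
  assumes K: "finite K"
  shows "size (finite_lifetimes (persistence_diagram l K f))
    \<le> min (card {\<sigma> \<in> K. card \<sigma> = l + 1}) (card {\<sigma> \<in> K. card \<sigma> = l + 2})"
proof -
  let ?T = "{(b, d). b \<in> f ` K \<and> d \<in> insert \<infinity> (ereal ` f ` K) \<and> ereal b < d}"
  let ?P = "{(b, d). b \<in> f ` K \<and> d \<in> f ` K \<and> b < d}"
  \<comment> \<open>Points with finite death correspond to pairs of real filtration values, the
    index set of \<open>pd_multiplicity_sum_le\<close>.\<close>
  have eq: "{x. x \<in> ?T \<and> (case x of (b, d) \<Rightarrow> d < \<infinity>)} = (\<lambda>(b, d). (b, ereal d)) ` ?P"
    by force
  have inj: "inj_on (\<lambda>(b, d). (b, ereal d)) ?P"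
    by (auto simp: inj_on_def)
  have "size (finite_lifetimes (persistence_diagram l K f))
      = (\<Sum>x | x \<in> ?T \<and> (case x of (b, d) \<Rightarrow> d < \<infinity>). pd_multiplicity l K f (fst x) (snd x))"
    by (simp only: finite_lifetimes_def size_image_mset persistence_diagram_eq
        size_filter_sum_replicate_mset[OF finite_diagram_support[OF K]])
  also have "\<dots> = (\<Sum>(b, d) \<in> ?P. pd_multiplicity l K f b (ereal d))"
    unfolding eq by (subst sum.reindex[OF inj]) (auto intro!: sum.cong)
  also have "\<dots> \<le> min (card {\<sigma> \<in> K. card \<sigma> = l + 1}) (card {\<sigma> \<in> K. card \<sigma> = l + 2})"
    by (rule pd_multiplicity_sum_le[OF K])
  finally show ?thesis .
qed

lemma in_finite_lifetimesE:
  assumes "finite K" "y \<in># finite_lifetimes (persistence_diagram l K f)"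
  obtains b d where "b \<in> f ` K" "d \<in> f ` K" "b < d" "y = d - b"
proof -
  from assms(2) obtain z where "z \<in># persistence_diagram l K f"
    "case z of (b, d) \<Rightarrow> d < \<infinity>" "y = (case z of (b, d) \<Rightarrow> real_of_ereal d - b)"
    unfolding finite_lifetimes_def set_image_mset set_mset_filter by blast
  then obtain b d where bd: "(b, d) \<in># persistence_diagram l K f" "d < \<infinity>" "y = real_of_ereal d - b"
    by (cases z) simp
  have "(b, d) \<in> {(b, d). b \<in> f ` K \<and> d \<in> insert \<infinity> (ereal ` f ` K) \<and> ereal b < d}"
  proof -
    obtain x where x: "x \<in> {(b, d). b \<in> f ` K \<and> d \<in> insert \<infinity> (ereal ` f ` K) \<and> ereal b < d}"
      "(b, d) \<in># replicate_mset (pd_multiplicity l K f (fst x) (snd x)) x"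
      using bd(1) unfolding persistence_diagram_eq set_mset_sum[OF finite_diagram_support[OF assms(1)]]
      by (rule UN_E)
    from x(2) have "(b, d) = x" by (simp only: in_replicate_mset)
    with x(1) show ?thesis by (simp only:)
  qed
  then have "b \<in> f ` K" "d \<in> insert \<infinity> (ereal ` f ` K)" "ereal b < d"
    by simp_all
  moreover from this(2) bd(2) obtain e where "e \<in> f ` K" "d = ereal e"
    by blast
  ultimately show thesis
    using bd(3) by (intro that[of b e]) simp_all
qed

lemma lifetime_bounds:
  assumes K: "finite K" and f: "\<And>\<sigma>. \<sigma> \<in> K \<Longrightarrow> f \<sigma> \<in> {0..D}"
    and y: "y \<in># finite_lifetimes (persistence_diagram l K f)"
  shows "0 \<le> y" "y \<le> D"
proof -
  obtain b d where bd: "b \<in> f ` K" "d \<in> f ` K" "b < d" "y = d - b"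
    by (rule in_finite_lifetimesE[OF K y])
  have "b \<in> {0..D}" "d \<in> {0..D}"
    using bd(1,2) f by blast+
  then show "0 \<le> y" "y \<le> D"
    using bd(3,4) by simp_all
qed

lemma sum_mset_bounds:
  fixes A :: "real multiset" and D :: real
  assumes "\<And>y. y \<in># A \<Longrightarrow> 0 \<le> y" "\<And>y. y \<in># A \<Longrightarrow> y \<le> D"
  shows "0 \<le> \<Sum>\<^sub># A \<and> \<Sum>\<^sub># A \<le> size A * D"
  using assms
proof (induction A)
  case (add y A)
  have "0 \<le> \<Sum>\<^sub># A \<and> \<Sum>\<^sub># A \<le> size A * D"
    by (rule add.IH) (simp_all add: add.prems)
  moreover have "0 \<le> y" "y \<le> D"
    by (simp_all add: add.prems)
  ultimately show ?case by (simp add: algebra_simps)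
qed simp


section \<open>Vietoris--Rips persistence and its moments\<close>

lemma vietoris_rips_bounds:
  fixes m :: real
  assumes \<sigma>: "\<sigma> \<in> full_simplex N" and m: "\<And>i. i \<in> {1..N} \<Longrightarrow> norm (x i) \<le> m"
  shows "vietoris_rips x \<sigma> \<in> {0..2 * m}"
proof -
  have \<sigma>': "\<sigma> \<noteq> {}" "finite \<sigma>" "\<sigma> \<subseteq> {1..N}"
    using \<sigma> finite_subset[of \<sigma> "{1..N}"] by (auto simp: full_simplex_def)
  let ?D = "{norm (x i - x j) | i j. i \<in> \<sigma> \<and> j \<in> \<sigma>}"
  have "?D = (\<lambda>(i, j). norm (x i - x j)) ` (\<sigma> \<times> \<sigma>)" by auto
  then have fin: "finite ?D" using \<sigma>'(2) by simp
  obtain i where i: "i \<in> \<sigma>" using \<sigma>'(1) by blast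
  \<comment> \<open>The diagonal pair shows that the set of distances is nonempty and that its
    maximum is at least 0.\<close>
  then have in_D: "norm (x i - x i) \<in> ?D" by blast
  have "0 \<le> Max ?D"
    using Max_ge[OF fin in_D] by simp
  moreover have "Max ?D \<le> 2 * m"
  proof (rule Max.boundedI[OF fin])
    fix r assume "r \<in> ?D"
    then obtain j k where jk: "j \<in> \<sigma>" "k \<in> \<sigma>" "r = norm (x j - x k)" by blast
    have "r \<le> norm (x j) + norm (x k)" unfolding jk(3) by (rule norm_triangle_ineq4)
    also have "\<dots> \<le> 2 * m" using m[of j] m[of k] jk \<sigma>'(3) by fastforce
    finally show "r \<le> 2 * m" .
  qed (use in_D in blast)
  ultimately show ?thesis by (simp add: vietoris_rips_def)
qed

lemma finite_full_simplex: "finite (full_simplex N)"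
  by (rule finite_subset[of _ "Pow {1..N}"]) (auto simp: full_simplex_def)

text \<open>The form \<open>Suc k\<close> makes the nonemptiness condition on simplices
  automatic.\<close>

lemma card_full_simplex: "card {\<sigma> \<in> full_simplex N. card \<sigma> = Suc k} = N choose Suc k"
proof -
  have "{\<sigma> \<in> full_simplex N. card \<sigma> = Suc k} = {\<sigma>. \<sigma> \<subseteq> {1..N} \<and> card \<sigma> = Suc k}"
    by (auto simp: full_simplex_def)
  then show ?thesis using n_subsets[of "{1..N}" "Suc k"] by simp
qed

lemma persistence_bounds:
  fixes L :: "(nat \<Rightarrow> real ^ 'd) \<Rightarrow> real" and m :: real
  assumes L: "L \<in> {total_persistence l N, max_persistence l N}"
    and m: "0 \<le> m" "\<And>i. i \<in> {1..N} \<Longrightarrow> norm (x i) \<le> m"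
  shows "0 \<le> L x" "L x \<le> n_VR l N * (2 * m)"
proof -
  let ?P = "finite_lifetimes (vr_diagram l N x)"
  have vr: "vietoris_rips x \<sigma> \<in> {0..2 * m}" if "\<sigma> \<in> full_simplex N" for \<sigma>
    by (rule vietoris_rips_bounds[OF that m(2)])
  have y: "0 \<le> y" "y \<le> 2 * m" if "y \<in># ?P" for y
    using lifetime_bounds[OF finite_full_simplex vr that[unfolded vr_diagram_def]] by blast+
  have "size ?P \<le> n_VR l N"
    using size_finite_lifetimes_le[OF finite_full_simplex, of l N "vietoris_rips x"]
      card_full_simplex[of N l] card_full_simplex[of N "Suc l"]
    by (simp add: vr_diagram_def n_VR_def)
  then have size: "size ?P * (2 * m) \<le> n_VR l N * (2 * m)"
    using m(1) by (intro mult_right_mono) auto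
  have total: "0 \<le> total_persistence l N x \<and> total_persistence l N x \<le> n_VR l N * (2 * m)"
    using sum_mset_bounds[of ?P "2 * m", OF y] size unfolding total_persistence_def by linarith
  have max: "0 \<le> max_persistence l N x \<and> max_persistence l N x \<le> n_VR l N * (2 * m)"
  proof (cases "?P = {#}")
    case True
    then show ?thesis using m(1) by (simp add: max_persistence_def)
  next
    case False
    then have "Max (set_mset ?P) \<in># ?P" by (intro Max_in) auto
    note max = y[OF this]
    \<comment> \<open>A nonempty diagram has at least one finite pair, so the bound
      \<open>2 * m\<close> on one lifetime is below the bound for the total.\<close>
    have "1 * (2 * m) \<le> size ?P * (2 * m)"
      using False m(1) by (intro mult_right_mono) (auto simp: Suc_le_eq nonempty_has_size)
    with max(2) size have "Max_mset ?P \<le> n_VR l N * (2 * m)" by linarith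
    with max(1) False show ?thesis by (simp only: max_persistence_def Let_def if_False simp_thms)
  qed
  show "0 \<le> L x" "L x \<le> n_VR l N * (2 * m)"
    using L max total by auto
qed

text \<open>The deterministic form of the theorem: the largest norm is attained at some index
  \<open>k\<close>, and its power is one term of the sum.\<close>

lemma persistence_powr_le:
  fixes L :: "(nat \<Rightarrow> real ^ 'd) \<Rightarrow> real"
  assumes L: "L \<in> {total_persistence l N, max_persistence l N}" and N: "N \<ge> 1" and p: "p \<ge> 0"
  shows "L x powr p \<le> 2 powr p * n_VR l N powr p * (\<Sum>i=1..N. norm (x i) powr p)"
proof -
  define m where "m = Max ((\<lambda>i. norm (x i)) ` {1..N})"
  have "m \<in> (\<lambda>i. norm (x i)) ` {1..N}"
    unfolding m_def using N by (intro Max_in) auto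
  then obtain k where k: "k \<in> {1..N}" "m = norm (x k)" by blast
  have m: "norm (x i) \<le> m" if "i \<in> {1..N}" for i
    using that by (simp add: m_def)
  have "0 \<le> m" using k by simp
  note b = persistence_bounds[OF L this m]
  have "L x powr p \<le> (n_VR l N * (2 * m)) powr p"
    using b p by (intro powr_mono2) auto
  also have "\<dots> = 2 powr p * n_VR l N powr p * norm (x k) powr p"
    by (simp add: powr_mult k(2))
  also have "\<dots> \<le> 2 powr p * n_VR l N powr p * (\<Sum>i=1..N. norm (x i) powr p)"
    using k(1) by (intro mult_left_mono member_le_sum) auto
  finally show ?thesis .
qed

theorem theorem2:
  fixes M :: "'w measure"
    and X :: "nat \<Rightarrow> 'w \<Rightarrow> real ^ 'd"
    and L :: "(nat \<Rightarrow> real ^ 'd) \<Rightarrow> real"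
    and N l :: nat
    and p :: real
  assumes "prob_space M"
    and "N \<ge> 1"
    and "\<And>i. i \<in> {1..N} \<Longrightarrow> X i \<in> borel_measurable M"
    and "\<And>i. i \<in> {1..N} \<Longrightarrow> distr M borel (X i) = distr M borel (X 1)"
    and "L \<in> {total_persistence l N, max_persistence l N}"
    and "p \<ge> 1"
  shows "(\<integral>\<^sup>+ \<omega>. ennreal (L (\<lambda>i. X i \<omega>) powr p) \<partial>M)
         \<le> ennreal (C_VR l p N) * (\<integral>\<^sup>+ \<omega>. ennreal (norm (X 1 \<omega>) powr p) \<partial>M)"
proof -
  let ?C = "2 powr p * n_VR l N powr p"
  \<comment> \<open>The moment depends only on the law of \<open>X i\<close>; independence does not
    enter.\<close>
  have moment: "(\<integral>\<^sup>+ \<omega>. ennreal (norm (X i \<omega>) powr p) \<partial>M)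
      = (\<integral>\<^sup>+ \<omega>. ennreal (norm (X 1 \<omega>) powr p) \<partial>M)" if i: "i \<in> {1..N}" for i
  proof -
    have 1: "1 \<in> {1..N}" using assms(2) by simp
    have "(\<integral>\<^sup>+ \<omega>. ennreal (norm (X j \<omega>) powr p) \<partial>M)
        = (\<integral>\<^sup>+ y. ennreal (norm y powr p) \<partial>distr M borel (X j))" if "j \<in> {1..N}" for j
      using assms(3)[OF that] by (subst nn_integral_distr) auto
    from this[OF i] this[OF 1] assms(4)[OF i] show ?thesis by simp
  qed
  have "(\<integral>\<^sup>+ \<omega>. ennreal (L (\<lambda>i. X i \<omega>) powr p) \<partial>M)
      \<le> (\<integral>\<^sup>+ \<omega>. ennreal ?C * (\<Sum>i=1..N. ennreal (norm (X i \<omega>) powr p)) \<partial>M)"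
  proof (rule nn_integral_mono)
    fix \<omega>
    show "ennreal (L (\<lambda>i. X i \<omega>) powr p) \<le> ennreal ?C * (\<Sum>i=1..N. ennreal (norm (X i \<omega>) powr p))"
      using ennreal_leI[OF persistence_powr_le[OF assms(5,2), of p "\<lambda>i. X i \<omega>"]] assms(6)
      by (subst sum_ennreal) (simp_all add: ennreal_mult sum_nonneg)
  qed
  also have "\<dots> = ennreal ?C * (\<integral>\<^sup>+ \<omega>. (\<Sum>i=1..N. ennreal (norm (X i \<omega>) powr p)) \<partial>M)"
    using assms(3) by (intro nn_integral_cmult borel_measurable_sum) auto
  also have "(\<integral>\<^sup>+ \<omega>. (\<Sum>i=1..N. ennreal (norm (X i \<omega>) powr p)) \<partial>M)
      = (\<Sum>i=1..N. \<integral>\<^sup>+ \<omega>. ennreal (norm (X i \<omega>) powr p) \<partial>M)"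
    using assms(3) by (intro nn_integral_sum) auto
  \<comment> \<open>Bounding a maximum by a sum costs the factor \<open>N\<close> of
    \<open>C_VR\<close>, here from \<open>N\<close> equal moments.\<close>
  also have "\<dots> = ennreal (real N) * (\<integral>\<^sup>+ \<omega>. ennreal (norm (X 1 \<omega>) powr p) \<partial>M)"
    by (simp only: sum.cong[OF refl moment] sum_constant card_atLeastAtMost diff_Suc_1
        ennreal_of_nat_eq_real_of_nat)
  also have "ennreal ?C * \<dots> = ennreal (C_VR l p N) * (\<integral>\<^sup>+ \<omega>. ennreal (norm (X 1 \<omega>) powr p) \<partial>M)"
  proof -
    have "ennreal ?C * ennreal (real N) = ennreal (?C * real N)"
      by (rule ennreal_mult[symmetric]) auto
    also have "?C * real N = C_VR l p N"
      by (simp only: C_VR_def ac_simps)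
    finally show ?thesis by (simp only: mult.assoc[symmetric])
  qed
  finally show ?thesis .
qed

end
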